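(* Let $I,J,K$ be pairwise disjoint countable index sets, let $r_i\in\mathbb{Z}_+$ for all $i\in I\cup J\cup K$ and $s_i\in\mathbb{Z}_{\geq0}$ for all $i\in I\cup J$, and put $\mathcal{U}=\{(r_i,s_i)\mid i\in I\}$, $\mathcal{V}=\{(r_i,s_i)\mid i\in J\}$, $\mathcal{W}=\{(r_i,-1)\mid i\in K\}$. Let $f:\mathbb{Z}_+\to\mathbb{C}$ and define $p_n$ and the generating functions below as in the context. Let \[U(x,y)=\sum_{i\in I}x^{r_i}y^{s_i},\quad V(x,y)=\sum_{i\in J}x^{r_i}y^{s_i},\quad W(x)=\sum_{i\in K}x^{r_i},\quad F(x)=1+\sum_{\ell=1}^\infty f(\ell)x^\ell,\quad P(x)=\sum_{n=0}^\infty p_nx^n.\] Then \[P(x)=F\big(U(x,W(x)P(x))\big)\big(1+P(x)V(x,W(x)P(x))\big).\]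
   Context: For $n\in\mathbb{Z}_{\geq0}$, $\mathcal{P}_n$ denotes the set of lattice paths from $(0,0)$ to $(n,0)$ that never go below the $x$-axis and each of whose steps lies in $\mathcal{U}\cup\mathcal{V}\cup\mathcal{W}$ (a step $(a,b)$ moves from $(x,y)$ to $(x+a,y+b)$). For $P\in\mathcal{P}_n$, $\mathbf{u}(P)$ is the vector recording, in order, the lengths (numbers of steps) of the maximal blocks of consecutive steps of $P$ that belong to $\mathcal{U}$. Then $p_n=\sum_{P\in\mathcal{P}_n}\prod_{i=1}^{|\mathbf{u}(P)|}f(\mathbf{u}(P)_i)$, with empty products equal to $1$. All identities are of formal power series in $x$.
   Formalization: False if steps repeat (e.g. U=V={(1,0)}, W empty). Proved in two readings: U, V, W as sets, assuming distinct indices in I∪J∪K give distinct steps; or repeated steps allowed, told apart by index, assuming each step has finitely many indices so that the series U, V, W are defined. *)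

theory Defs
  imports
    "HOL-Computational_Algebra.Formal_Power_Series"
    "HOL-Library.Countable_Set"
    "HOL-Library.Product_Plus"
begin

(* A path is the list of its steps, taken from a set S of steps (or of step labels), where
   d gives the displacement of a step.  With d = id the steps are the displacements themselves;
   a general d allows different steps with the same displacement ("coloured" steps).
   Heights only need to be tested at lattice points, since a path is piecewise linear. *)
definition lattice_paths :: "'a set \<Rightarrow> ('a \<Rightarrow> int \<times> int) \<Rightarrow> nat \<Rightarrow> 'a list set" where
  "lattice_paths S d n =
     {p. set p \<subseteq> S \<and> (\<Sum>\<sigma>\<leftarrow>p. d \<sigma>) = (int n, 0) \<and>
         (\<forall>k \<le> length p. 0 \<le> snd (\<Sum>\<sigma>\<leftarrow>take k p. d \<sigma>))}"

(* The lengths, in order, of the maximal blocks of consecutive entries satisfying Q. *)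
function block_lengths :: "('a \<Rightarrow> bool) \<Rightarrow> 'a list \<Rightarrow> nat list" where
  "block_lengths Q [] = []"
| "block_lengths Q (x # xs) =
     (if Q x then Suc (length (takeWhile Q xs)) # block_lengths Q (dropWhile Q xs)
      else block_lengths Q xs)"
  by pat_completeness auto
termination
  by (relation "measure (length \<circ> snd)") (auto simp: le_imp_less_Suc length_dropWhile_le)

definition path_weight :: "(nat \<Rightarrow> complex) \<Rightarrow> 'a set \<Rightarrow> 'a list \<Rightarrow> complex" where
  "path_weight f A p = (\<Prod>l\<leftarrow>block_lengths (\<lambda>\<sigma>. \<sigma> \<in> A) p. f l)"

(* The generating function P(x) for paths with steps in S, weighted by their A-blocks. *)
definition path_gf :: "(nat \<Rightarrow> complex) \<Rightarrow> 'a set \<Rightarrow> 'a set \<Rightarrow> ('a \<Rightarrow> int \<times> int) \<Rightarrow> complex fps" where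
  "path_gf f A S d = Abs_fps (\<lambda>n. \<Sum>p\<in>lattice_paths S d n. path_weight f A p)"

(* The sum over i in K of x^(r i); meaningful if the sets counted here are finite. *)
definition family_gf :: "'i set \<Rightarrow> ('i \<Rightarrow> nat) \<Rightarrow> complex fps" where
  "family_gf K r = Abs_fps (\<lambda>a. of_nat (card {i \<in> K. r i = a}))"

(* The sum over i in I of x^(r i) y^(s i); meaningful if the sets counted here are finite.
   A series in x and y is an element of C[[x]][[y]]: the outer index is the exponent of y,
   the inner one that of x. *)
definition family_gf2 :: "'i set \<Rightarrow> ('i \<Rightarrow> nat) \<Rightarrow> ('i \<Rightarrow> nat) \<Rightarrow> complex fps fps" where
  "family_gf2 I r s = Abs_fps (\<lambda>b. Abs_fps (\<lambda>a. of_nat (card {i \<in> I. r i = a \<and> s i = b})))"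

(* A(x, G(x)) for A in C[[x]][[y]] and G with G(0) = 0.  As in fps_compose, the terms with b > n
   do not contribute to the coefficient of x^n; see fps_subst_y_sums. *)
definition fps_subst_y :: "complex fps fps \<Rightarrow> complex fps \<Rightarrow> complex fps" where
  "fps_subst_y A G = Abs_fps (\<lambda>n. \<Sum>b\<le>n. fps_nth (fps_nth A b * G ^ b) n)"

lemma fps_subst_y_sums:
  assumes "fps_nth G 0 = 0"
  shows "(\<lambda>b. fps_nth A b * G ^ b) sums fps_subst_y A G"
  unfolding sums_def
proof (rule tendsto_fpsI)
  fix n
  have z: "fps_nth (fps_nth A b * G ^ b) n = 0" if "n < b" for b
    using that startsby_zero_power_prefix[OF assms]
    by (auto simp: fps_mult_nth intro!: sum.neutral)
  have "fps_nth (\<Sum>b<m. fps_nth A b * G ^ b) n = fps_nth (fps_subst_y A G) n" if "m > n" for m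
    using that z
    by (auto simp: fps_subst_y_def fps_sum_nth not_le[symmetric] intro!: sum.mono_neutral_right)
  then show "\<forall>\<^sub>F m in sequentially.
      fps_nth (\<Sum>b<m. fps_nth A b * G ^ b) n = fps_nth (fps_subst_y A G) n"
    by (rule eventually_mono[OF eventually_gt_at_top])
qed

end

theory Submission
  imports Defs
begin

unbundle fps_syntax

text \<open>
  Let \<open>C k h\<close> be the generating function of the paths from height \<open>h\<close> to height \<open>0\<close> that are preceded
  by \<open>k\<close> steps of \<open>I\<close>, so that an initial \<open>I\<close>-block of length \<open>l\<close> contributes \<open>f (k + l)\<close>.
  Removing the first step gives a linear recurrence for the family \<open>C\<close>. As every step has positive
  length, it can be compared coefficientwise with the same recurrence one level higher, which
  yields \<open>C k (h + 1) = C k h * W * P\<close> with \<open>P = C 0 0\<close>. For \<open>h = 0\<close> the recurrence then reads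
  \<open>C k 0 = F\<^sub>k (1 + P V(x, W P)) + U(x, W P) C (k + 1) 0\<close>, and unrolling it in \<open>k\<close>
  produces the composition with \<open>F\<close>.
\<close>

section \<open>Path weights with a pending initial block\<close>

primrec open_weight :: "(nat \<Rightarrow> complex) \<Rightarrow> 'a set \<Rightarrow> nat \<Rightarrow> 'a list \<Rightarrow> complex" where
  "open_weight F A k [] = F k"
| "open_weight F A k (x # p) = (if x \<in> A then open_weight F A (Suc k) p else F k * open_weight F A 0 p)"

text \<open>A block is charged once, when a step outside \<open>A\<close> or the end of the path
  closes it, so the \<open>k\<close> pending steps merge with the initial run of
  \<open>A\<close>-steps.\<close>

lemma open_weight_eq:
  assumes "F 0 = 1" "\<And>k. k > 0 \<Longrightarrow> F k = f k"
  shows "open_weight F A k p = F (k + length (takeWhile (\<lambda>x. x \<in> A) p)) * path_weight f A (dropWhile (\<lambda>x. x \<in> A) p)"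
proof (induction p arbitrary: k)
  case Nil
  then show ?case by (simp add: path_weight_def)
next
  case (Cons x p)
  show ?case
  proof (cases "x \<in> A")
    case True
    then show ?thesis using Cons[of "Suc k"] by simp
  next
    case False
    \<comment> \<open>The closing step resets the count to 0. If \<open>p\<close> does not start in
      \<open>A\<close>, its initial run is empty and costs \<open>F 0 = 1\<close>; otherwise the run
      has positive length, where \<open>F\<close> is \<open>f\<close>.\<close>
    have "open_weight F A 0 p = path_weight f A p"
    proof (cases p)
      case Nil
      then show ?thesis using assms by (simp add: path_weight_def)
    next
      case (Cons y q)
      then show ?thesis using assms Cons.IH[of 0] by (simp add: path_weight_def)
    qed
    then show ?thesis using False by (simp add: path_weight_def)
  qed
qed

lemma open_weight_0:
  assumes "F 0 = 1" "\<And>k. k > 0 \<Longrightarrow> F k = f k"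
  shows "open_weight F A 0 p = path_weight f A p"
proof (cases p)
  case Nil
  then show ?thesis using assms by (simp add: path_weight_def)
next
  case (Cons x q)
  have "open_weight F A 0 p
      = F (length (takeWhile (\<lambda>x. x \<in> A) p)) * path_weight f A (dropWhile (\<lambda>x. x \<in> A) p)"
    using open_weight_eq[where F = F and f = f and A = A and k = 0 and p = p] assms by simp
  then show ?thesis using assms Cons by (simp add: path_weight_def)
qed

section \<open>Relabelling steps\<close>

lemma block_lengths_map: "block_lengths Q (map g p) = block_lengths (Q \<circ> g) p"
  by (induction "Q \<circ> g" p rule: block_lengths.induct)
     (simp_all add: takeWhile_map dropWhile_map comp_def)

lemma path_weight_map:
  assumes "inj_on g S" "A \<subseteq> S" "set p \<subseteq> S"
  shows "path_weight f (g ` A) (map g p) = path_weight f A p"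
proof -
  have "block_lengths Q p = block_lengths Q' p" if "\<forall>x\<in>set p. Q x = Q' x" for Q Q'
    using that
  proof (induction Q p rule: block_lengths.induct)
    case (2 Q x xs)
    have tw: "takeWhile Q xs = takeWhile Q' xs" "dropWhile Q xs = dropWhile Q' xs"
      using 2(3) by (auto intro: takeWhile_cong dropWhile_cong)
    have "set (dropWhile Q xs) \<subseteq> set xs"
      using set_dropWhileD by fast
    then show ?case
      using 2 tw by (cases "Q x") auto
  qed simp
  moreover have "\<forall>x\<in>set p. ((\<lambda>y. y \<in> g ` A) \<circ> g) x = (x \<in> A)"
    using assms by (auto simp: inj_on_def)
  ultimately show ?thesis
    unfolding path_weight_def block_lengths_map by metis
qed

lemma lattice_paths_image:
  "lattice_paths (g ` S) id n = map g ` lattice_paths S g n"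
proof
  show "lattice_paths (g ` S) id n \<subseteq> map g ` lattice_paths S g n"
  proof
    fix q assume q: "q \<in> lattice_paths (g ` S) id n"
    then have "q \<in> lists (g ` S)" by (auto simp: lattice_paths_def)
    then obtain p where p: "p \<in> lists S" "q = map g p" by (auto simp: lists_image)
    then have "p \<in> lattice_paths S g n"
      using q by (auto simp: lattice_paths_def take_map)
    then show "q \<in> map g ` lattice_paths S g n" using p by blast
  qed
qed (force simp: lattice_paths_def take_map)

text \<open>For distinct displacements \<open>map g\<close> is a weight-preserving bijection from
  labelled paths to paths of displacements. This reduces sets of steps to indexed families.\<close>

lemma path_gf_image:
  assumes "inj_on g S" "A \<subseteq> S"
  shows "path_gf f (g ` A) (g ` S) id = path_gf f A S g"
proof -
  have "inj_on (map g) (lattice_paths S g n)" for n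
    using assms by (auto simp: lattice_paths_def inj_on_map_eq_map inj_on_def subset_iff
        intro!: map_inj_on[of g])
  then have "(\<Sum>p\<in>lattice_paths (g ` S) id n. path_weight f (g ` A) p)
      = (\<Sum>p\<in>lattice_paths S g n. path_weight f A p)" for n
    unfolding lattice_paths_image
    by (subst sum.reindex) (auto intro!: sum.cong path_weight_map[OF assms] simp: lattice_paths_def)
  then show ?thesis by (simp add: path_gf_def)
qed

section \<open>Sums over possibly infinite families of steps\<close>

text \<open>The sum over \<open>i\<close> in \<open>A\<close> of \<open>x ^ r i * Q (s i)\<close>. The truncation at \<open>s i \<le> n\<close> keeps the sums finite and
  loses nothing if \<open>Q b\<close> is divisible by \<open>x ^ b\<close>.\<close>
definition shifted_sum :: "'i set \<Rightarrow> ('i \<Rightarrow> nat) \<Rightarrow> ('i \<Rightarrow> nat) \<Rightarrow> (nat \<Rightarrow> complex fps) \<Rightarrow> complex fps" where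
  "shifted_sum A r s Q =
     Abs_fps (\<lambda>n. \<Sum>i | i \<in> A \<and> r i \<le> n \<and> s i \<le> n. (fps_X ^ r i * Q (s i)) $ n)"

lemma finite_truncated_family:
  fixes r s :: "'i \<Rightarrow> nat"
  assumes "\<And>a b. finite {i \<in> A. r i = a \<and> s i = b}"
  shows "finite {i. i \<in> A \<and> r i \<le> n \<and> s i \<le> n}"
proof -
  have "{i. i \<in> A \<and> r i \<le> n \<and> s i \<le> n} = (\<Union>a\<le>n. \<Union>b\<le>n. {i \<in> A. r i = a \<and> s i = b})" by auto
  then show ?thesis using assms by simp
qed

text \<open>The indices gained by raising the cutoff contribute 0: those with \<open>r i > n\<close>
  by the factor \<open>fps_X ^ r i\<close>, those with \<open>s i > n\<close> by the divisibility of
  \<open>Q (s i)\<close>. So one finite sum serves all coefficients up to \<open>N\<close>.\<close>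

lemma shifted_sum_nth:
  assumes "\<And>a b. finite {i \<in> A. r i = a \<and> s i = b}"
    and "\<And>b m. m < b \<Longrightarrow> Q b $ m = 0" and "n \<le> N"
  shows "shifted_sum A r s Q $ n
    = (\<Sum>i | i \<in> A \<and> r i \<le> N \<and> s i \<le> N. fps_X ^ r i * Q (s i)) $ n"
  unfolding shifted_sum_def fps_nth_Abs_fps fps_sum_nth
proof (intro sum.mono_neutral_left ballI)
  fix i assume i: "i \<in> {i. i \<in> A \<and> r i \<le> N \<and> s i \<le> N} - {i. i \<in> A \<and> r i \<le> n \<and> s i \<le> n}"
  then show "(fps_X ^ r i * Q (s i)) $ n = 0"
    using assms(2)[of "n - r i" "s i"] by (auto simp: fps_X_power_mult_nth)
qed (use assms(3) finite_truncated_family[OF assms(1)] in auto)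

lemma shifted_sum_mult:
  assumes fin: "\<And>a b. finite {i \<in> A. r i = a \<and> s i = b}"
    and Q: "\<And>b m. m < b \<Longrightarrow> Q b $ m = 0"
  shows "shifted_sum A r s (\<lambda>b. Q b * G) = shifted_sum A r s Q * G"
proof (rule fps_ext)
  fix n
  \<comment> \<open>\<open>?T\<close> agrees with the full sum up to order \<open>n\<close>, which
    is all that coefficient \<open>n\<close> of a product sees.\<close>
  let ?T = "\<Sum>i | i \<in> A \<and> r i \<le> n \<and> s i \<le> n. fps_X ^ r i * Q (s i)"
  have "(shifted_sum A r s Q * G) $ n = (?T * G) $ n"
    unfolding fps_mult_nth using shifted_sum_nth[OF fin Q, where N = n]
    by (intro sum.cong) auto
  also have "\<dots> = shifted_sum A r s (\<lambda>b. Q b * G) $ n"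
    by (simp add: shifted_sum_def sum_distrib_right fps_sum_nth mult.assoc)
  finally show "shifted_sum A r s (\<lambda>b. Q b * G) $ n = (shifted_sum A r s Q * G) $ n" ..
qed

text \<open>Both sides cut the exponent of \<open>y\<close> off at \<open>n\<close>; grouping the
  indices by \<open>(s i, r i)\<close> gives fibres whose sizes are the coefficients of
  \<open>family_gf2\<close>.\<close>

lemma shifted_sum_powers:
  assumes fin: "\<And>a b. finite {i \<in> A. r i = a \<and> s i = b}"
  shows "shifted_sum A r s (\<lambda>b. G ^ b) = fps_subst_y (family_gf2 A r s) G"
proof (rule fps_ext)
  fix n
  let ?T = "{i. i \<in> A \<and> r i \<le> n \<and> s i \<le> n}"
  let ?g = "\<lambda>i. (s i, r i)"
  have "fps_subst_y (family_gf2 A r s) G $ n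
      = (\<Sum>b\<le>n. \<Sum>a\<le>n. of_nat (card {i \<in> A. r i = a \<and> s i = b}) * (G ^ b) $ (n - a))"
    by (simp add: fps_subst_y_def family_gf2_def fps_mult_nth atLeast0AtMost)
  also have "\<dots> = (\<Sum>(b, a)\<in>{..n} \<times> {..n}. of_nat (card {i \<in> A. r i = a \<and> s i = b}) * (G ^ b) $ (n - a))"
    by (rule sum.cartesian_product)
  also have "\<dots> = (\<Sum>c\<in>{..n} \<times> {..n}. \<Sum>i | i \<in> ?T \<and> ?g i = c. (fps_X ^ r i * G ^ s i) $ n)"
  proof (rule sum.cong)
    fix c assume c: "c \<in> {..n} \<times> {..n}"
    obtain b a where ba: "c = (b, a)" by force
    have "{i. i \<in> ?T \<and> ?g i = c} = {i \<in> A. r i = a \<and> s i = b}" using c ba by auto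
    moreover have "(\<Sum>i\<in>{i \<in> A. r i = a \<and> s i = b}. (fps_X ^ r i * G ^ s i) $ n)
        = of_nat (card {i \<in> A. r i = a \<and> s i = b}) * (G ^ b) $ (n - a)"
      unfolding sum_constant[symmetric] using c ba by (intro sum.cong) (auto simp: fps_X_power_mult_nth)
    ultimately show "(case c of (b, a) \<Rightarrow> of_nat (card {i \<in> A. r i = a \<and> s i = b}) * (G ^ b) $ (n - a))
        = (\<Sum>i | i \<in> ?T \<and> ?g i = c. (fps_X ^ r i * G ^ s i) $ n)"
      using ba by (simp only: case_prod_conv)
  qed simp
  also have "\<dots> = (\<Sum>i\<in>?T. (fps_X ^ r i * G ^ s i) $ n)"
    using finite_truncated_family[OF fin] by (intro sum.group) auto
  finally show "shifted_sum A r s (\<lambda>b. G ^ b) $ n = fps_subst_y (family_gf2 A r s) G $ n"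
    by (simp add: shifted_sum_def)
qed

lemma shifted_sum_geometric:
  assumes fin: "\<And>a b. finite {i \<in> A. r i = a \<and> s i = b}" and G: "G $ 0 = 0"
  shows "shifted_sum A r s (\<lambda>b. C * G ^ b) = fps_subst_y (family_gf2 A r s) G * C"
proof -
  have "(G ^ b) $ m = 0" if "m < b" for b m
    using startsby_zero_power_prefix[OF G] that by auto
  from shifted_sum_mult[OF fin this, where G = C] show ?thesis
    by (simp add: shifted_sum_powers[OF fin] mult.commute)
qed

lemma family_gf_mult_nth:
  assumes fin: "\<And>a. finite {i \<in> K. r i = a}"
  shows "(family_gf K r * Q) $ n = (\<Sum>i | i \<in> K \<and> r i \<le> n. Q $ (n - r i))"
proof -
  have "(family_gf K r * Q) $ n = (\<Sum>a\<le>n. \<Sum>i | i \<in> {i. i \<in> K \<and> r i \<le> n} \<and> r i = a. Q $ (n - r i))"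
    unfolding fps_mult_nth atLeast0AtMost
  proof (rule sum.cong)
    fix a assume "a \<in> {..n}"
    then have "{i. i \<in> {i. i \<in> K \<and> r i \<le> n} \<and> r i = a} = {i \<in> K. r i = a}" by auto
    then show "family_gf K r $ a * Q $ (n - a)
        = (\<Sum>i | i \<in> {i. i \<in> K \<and> r i \<le> n} \<and> r i = a. Q $ (n - r i))"
      by (simp add: family_gf_def)
  qed simp
  also have "\<dots> = (\<Sum>i | i \<in> K \<and> r i \<le> n. Q $ (n - r i))"
  proof (rule sum.group)
    have "{i. i \<in> K \<and> r i \<le> n} = (\<Union>a\<le>n. {i \<in> K. r i = a})" by auto
    then show "finite {i. i \<in> K \<and> r i \<le> n}" using fin by simp
  qed auto
  finally show ?thesis .
qed

section \<open>First-step recurrence for paths from a given height\<close>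

locale step_families =
  fixes I J K :: "'i set" and r s :: "'i \<Rightarrow> nat" and F :: "nat \<Rightarrow> complex"
  assumes disj: "I \<inter> J = {}" "I \<inter> K = {}" "J \<inter> K = {}"
    and r_pos: "\<And>i. i \<in> I \<union> J \<union> K \<Longrightarrow> r i > 0"
    and fin_I: "\<And>a b. finite {i \<in> I. r i = a \<and> s i = b}"
    and fin_J: "\<And>a b. finite {i \<in> J. r i = a \<and> s i = b}"
    and fin_K: "\<And>a. finite {i \<in> K. r i = a}"
begin

definition step :: "'i \<Rightarrow> int \<times> int" where
  "step i = (int (r i), if i \<in> K then -1 else int (s i))"

text \<open>Recursion on the list makes removing the first step definitional. The guard
  \<open>h > 0\<close> keeps the path above the axis and \<open>h - 1\<close> exact in the
  naturals.\<close>

primrec path_from :: "nat \<Rightarrow> 'i list \<Rightarrow> bool" where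
  "path_from h [] \<longleftrightarrow> h = 0"
| "path_from h (i # p) \<longleftrightarrow>
     (if i \<in> K then h > 0 \<and> path_from (h - 1) p else i \<in> I \<union> J \<and> path_from (h + s i) p)"

definition paths :: "nat \<Rightarrow> nat \<Rightarrow> 'i list set" where
  "paths h n = {p. path_from h p \<and> sum_list (map r p) = n}"

definition C :: "nat \<Rightarrow> nat \<Rightarrow> complex fps" where
  "C k h = Abs_fps (\<lambda>n. \<Sum>p\<in>paths h n. open_weight F I k p)"

lemma path_from_iff:
  "path_from h p \<longleftrightarrow> set p \<subseteq> I \<union> J \<union> K \<and> int h + snd (\<Sum>i\<leftarrow>p. step i) = 0 \<and>
     (\<forall>k \<le> length p. 0 \<le> int h + snd (\<Sum>i\<leftarrow>take k p. step i))"
proof (induction p arbitrary: h)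
  case Nil
  then show ?case by simp
next
  case (Cons i p)
  have all_le_Suc: "(\<forall>k\<le>Suc m. R k) \<longleftrightarrow> R 0 \<and> (\<forall>k\<le>m. R (Suc k))" for m and R :: "nat \<Rightarrow> bool"
    by (metis Suc_le_mono le0 not0_implies_Suc)
  show ?case
  proof (cases "i \<in> K")
    case True
    show ?thesis
    proof (cases h)
      case 0
      \<comment> \<open>The witness 1 is the prefix consisting of the descent alone, which ends at
        height -1.\<close>
      then show ?thesis using True by (auto simp: step_def intro!: exI[of _ 1])
    next
      case (Suc h')
      then show ?thesis using True by (simp add: all_le_Suc Cons step_def)
    qed
  next
    case False
    then show ?thesis by (auto simp: all_le_Suc Cons step_def add.assoc)
  qed
qed

lemma lattice_paths_eq: "lattice_paths (I \<union> J \<union> K) step n = paths 0 n"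
proof -
  have "fst (\<Sum>i\<leftarrow>p. step i) = int (sum_list (map r p))" for p
    by (induction p) (auto simp: step_def)
  then show ?thesis
    by (auto simp: lattice_paths_def paths_def path_from_iff prod_eq_iff)
qed

text \<open>Each descent lowers the height by 1 and has length at least 1. Hence
  \<open>C k h\<close> is divisible by \<open>x ^ h\<close>, as the truncation in
  \<open>shifted_sum\<close> requires.\<close>

lemma path_from_le: "path_from h p \<Longrightarrow> h \<le> sum_list (map r p)"
proof (induction p arbitrary: h)
  case (Cons i p)
  show ?case
  proof (cases "i \<in> K")
    case True
    then have "h - 1 \<le> sum_list (map r p)" "r i > 0" using Cons r_pos by auto
    then show ?thesis by simp
  next
    case False
    then have "h + s i \<le> sum_list (map r p)" using Cons by auto
    then show ?thesis by simp
  qed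
qed simp

lemma paths_empty: "n < h \<Longrightarrow> paths h n = {}"
  using path_from_le by (fastforce simp: paths_def)

lemma C_nth_zero: "n < h \<Longrightarrow> C k h $ n = 0"
  by (simp add: C_def paths_empty)

abbreviation low :: "'i set \<Rightarrow> nat \<Rightarrow> 'i set" where
  "low A n \<equiv> {i. i \<in> A \<and> r i \<le> n \<and> s i \<le> n}"

lemma finite_low: "finite (low I n)" "finite (low J n)" "finite {i. i \<in> K \<and> r i \<le> n}"
proof -
  have "{i. i \<in> K \<and> r i \<le> n} = (\<Union>a\<le>n. {i \<in> K. r i = a})" by auto
  then show "finite {i. i \<in> K \<and> r i \<le> n}" using fin_K by simp
qed (simp_all add: finite_truncated_family fin_I fin_J)

lemma paths_first_step:
  "paths h n = (if h = 0 \<and> n = 0 then {[]} else {})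
     \<union> (\<Union>i\<in>low I n. (#) i ` paths (h + s i) (n - r i))
     \<union> (\<Union>i\<in>low J n. (#) i ` paths (h + s i) (n - r i))
     \<union> (\<Union>i\<in>{i. i \<in> K \<and> r i \<le> n}. if h = 0 then {} else (#) i ` paths (h - 1) (n - r i))"
  (is "_ = ?R")
proof (rule set_eqI)
  fix p
  show "p \<in> paths h n \<longleftrightarrow> p \<in> ?R"
  proof (cases p)
    case Nil
    then show ?thesis by (auto simp: paths_def)
  next
    case (Cons i q)
    have "i # q \<in> paths h n \<longleftrightarrow> r i \<le> n \<and>
        (if i \<in> K then h > 0 \<and> q \<in> paths (h - 1) (n - r i)
         else i \<in> I \<union> J \<and> q \<in> paths (h + s i) (n - r i))"
      by (auto simp: paths_def)
    \<comment> \<open>The rest must come down from \<open>h + s i\<close> within length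
      \<open>n - r i\<close>, so the cutoff in \<open>low\<close> excludes no path.\<close>
    moreover have "s i \<le> n" if "q \<in> paths (h + s i) (n - r i)"
      using that path_from_le[of "h + s i" q] by (simp add: paths_def)
    ultimately show ?thesis using disj Cons by (cases "i \<in> K") auto
  qed
qed

lemma finite_paths: "finite (paths h n)"
proof (induction n arbitrary: h rule: less_induct)
  case (less n)
  have "finite (paths h' (n - r i))" if "i \<in> I \<union> J \<union> K" "r i \<le> n" for h' i
    using less[of "n - r i"] r_pos[OF that(1)] that by simp
  then show ?case
    unfolding paths_first_step[of h n] using finite_low[of n]
    by (intro finite_UnI finite_UN_I) (auto intro!: finite_imageI)
qed

text \<open>The pieces of \<open>paths_first_step\<close> are disjoint, so their weights add up. A
  first step in \<open>I\<close> extends the pending block; one in \<open>J\<close> or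
  \<open>K\<close> closes it, which gives the factor \<open>F k\<close> and restarts the count at
  0.\<close>

lemma C_nth:
  "C k h $ n = (if h = 0 \<and> n = 0 then F k else 0)
     + (\<Sum>i\<in>low I n. C (Suc k) (h + s i) $ (n - r i))
     + F k * (\<Sum>i\<in>low J n. C 0 (h + s i) $ (n - r i))
     + (if h = 0 then 0 else F k * (\<Sum>i | i \<in> K \<and> r i \<le> n. C 0 (h - 1) $ (n - r i)))"
proof -
  let ?w = "open_weight F I k"
  let ?E = "if h = 0 \<and> n = 0 then {[]} else {} :: 'i list set"
  let ?p = "\<lambda>i. (#) i ` paths (h + s i) (n - r i)"
  let ?q = "\<lambda>i. if h = 0 then {} else (#) i ` paths (h - 1) (n - r i)"
  let ?KK = "{i. i \<in> K \<and> r i \<le> n}"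
  have union: "sum ?w (\<Union>i\<in>A. B i) = (\<Sum>i\<in>A. sum ?w (B i))"
    if "finite A" "\<And>i. finite (B i)" "\<And>i. B i \<subseteq> range ((#) i)" for A B
  proof (rule sum.UNION_disjoint)
    show "\<forall>i\<in>A. \<forall>j\<in>A. i \<noteq> j \<longrightarrow> B i \<inter> B j = {}"
    proof (intro ballI impI)
      fix i j :: 'i assume "i \<noteq> j"
      then show "B i \<inter> B j = {}" using that(3)[of i] that(3)[of j] by auto
    qed
  qed (use that in auto)
  have cons: "sum ?w ((#) i ` X) = (\<Sum>p\<in>X. ?w (i # p))" for i X
    by (subst sum.reindex) (auto simp: inj_on_def)
  have I: "sum ?w (\<Union>i\<in>low I n. ?p i) = (\<Sum>i\<in>low I n. C (Suc k) (h + s i) $ (n - r i))"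
    by (subst union) (auto simp: finite_low finite_paths cons C_def intro!: sum.cong)
  have J: "sum ?w (\<Union>i\<in>low J n. ?p i) = F k * (\<Sum>i\<in>low J n. C 0 (h + s i) $ (n - r i))"
    unfolding sum_distrib_left using disj
    by (subst union) (auto simp: finite_low finite_paths cons C_def sum_distrib_left intro!: sum.cong)
  have K: "sum ?w (\<Union>i\<in>?KK. ?q i)
      = (if h = 0 then 0 else F k * (\<Sum>i\<in>?KK. C 0 (h - 1) $ (n - r i)))"
    unfolding sum_distrib_left using disj
    by (subst union) (auto simp: finite_low finite_paths cons C_def sum_distrib_left intro!: sum.cong)
  have "C k h $ n = sum ?w (?E \<union> (\<Union>i\<in>low I n. ?p i) \<union> (\<Union>i\<in>low J n. ?p i) \<union> (\<Union>i\<in>?KK. ?q i))"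
    unfolding C_def fps_nth_Abs_fps by (subst paths_first_step) simp
  also have "\<dots> = sum ?w ?E + sum ?w (\<Union>i\<in>low I n. ?p i) + sum ?w (\<Union>i\<in>low J n. ?p i)
      + sum ?w (\<Union>i\<in>?KK. ?q i)"
  proof -
    have "?E \<inter> (\<Union>i\<in>low I n. ?p i) = {}"
      "(?E \<union> (\<Union>i\<in>low I n. ?p i)) \<inter> (\<Union>i\<in>low J n. ?p i) = {}"
      "(?E \<union> (\<Union>i\<in>low I n. ?p i) \<union> (\<Union>i\<in>low J n. ?p i)) \<inter> (\<Union>i\<in>?KK. ?q i) = {}"
      using disj by (auto split: if_splits)
    moreover have "finite ?E" "finite (\<Union>i\<in>low I n. ?p i)" "finite (\<Union>i\<in>low J n. ?p i)"
      "finite (\<Union>i\<in>?KK. ?q i)"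
      using finite_low finite_paths by simp_all
    ultimately show ?thesis by (simp only: sum.union_disjoint finite_Un simp_thms)
  qed
  finally show ?thesis unfolding I J K by simp
qed

abbreviation W :: "complex fps" where "W \<equiv> family_gf K r"
abbreviation P :: "complex fps" where "P \<equiv> C 0 0"

lemma C_first_step:
  "C k h = (if h = 0 then fps_const (F k) else 0)
     + shifted_sum I r s (\<lambda>b. C (Suc k) (h + b))
     + fps_const (F k) * shifted_sum J r s (\<lambda>b. C 0 (h + b))
     + (if h = 0 then 0 else fps_const (F k) * (W * C 0 (h - 1)))"
proof (rule fps_ext)
  fix n
  have "shifted_sum A r s Q $ n = (\<Sum>i\<in>low A n. Q (s i) $ (n - r i))" for A Q
    by (auto simp: shifted_sum_def fps_X_power_mult_nth intro!: sum.cong)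
  then show "C k h $ n = ((if h = 0 then fps_const (F k) else 0)
     + shifted_sum I r s (\<lambda>b. C (Suc k) (h + b))
     + fps_const (F k) * shifted_sum J r s (\<lambda>b. C 0 (h + b))
     + (if h = 0 then 0 else fps_const (F k) * (W * C 0 (h - 1)))) $ n"
    by (subst C_nth) (simp add: family_gf_mult_nth[OF fin_K])
qed

section \<open>Solving the recurrence\<close>

lemma W_0: "W $ 0 = 0"
proof -
  have e: "{i \<in> K. r i = 0} = {}" using r_pos by force
  show ?thesis by (simp add: family_gf_def e)
qed

text \<open>Combinatorially, a path from height \<open>h + 1\<close> is cut at its first visit to
  height 0: the descent arriving there follows a path that stays at height at least 1, and it
  separates the blocks, so weights multiply.\<close>

lemma C_Suc_height: "C k (Suc h) = C k h * (W * P)"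
proof (rule fps_ext)
  fix n
  show "C k (Suc h) $ n = (C k h * (W * P)) $ n"
  proof (induction n arbitrary: k h rule: less_induct)
    case (less n)
    let ?G = "W * P"
    have shift: "shifted_sum A r s (\<lambda>b. C k' (Suc (h + b))) $ n
        = (shifted_sum A r s (\<lambda>b. C k' (h + b)) * ?G) $ n"
      if A: "A = I \<or> A = J" for A k'
    proof -
      have "shifted_sum A r s (\<lambda>b. C k' (Suc (h + b))) $ n
          = shifted_sum A r s (\<lambda>b. C k' (h + b) * ?G) $ n"
        unfolding shifted_sum_def fps_nth_Abs_fps
      proof (rule sum.cong)
        fix i assume i: "i \<in> low A n"
        then have "r i > 0" using r_pos A by auto
        with i show "(fps_X ^ r i * C k' (Suc (h + s i))) $ n
            = (fps_X ^ r i * (C k' (h + s i) * ?G)) $ n"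
          unfolding fps_X_power_mult_nth using less[of "n - r i" k' "h + s i"] by simp
      qed simp
      also have "shifted_sum A r s (\<lambda>b. C k' (h + b) * ?G) = shifted_sum A r s (\<lambda>b. C k' (h + b)) * ?G"
        using A fin_I fin_J by (intro shifted_sum_mult) (auto simp: C_nth_zero)
      finally show ?thesis .
    qed
    \<comment> \<open>\<open>W $ 0 = 0\<close> kills the term \<open>a = 0\<close>, so the induction
      hypothesis covers all remaining coefficients.\<close>
    have down: "(W * C 0 (Suc h')) $ n = (W * (C 0 h' * ?G)) $ n" for h'
      unfolding fps_mult_nth[of W]
    proof (rule sum.cong)
      fix a assume "a \<in> {0..n}"
      then show "W $ a * C 0 (Suc h') $ (n - a) = W $ a * (C 0 h' * ?G) $ (n - a)"
        using less[of "n - a" 0 h'] W_0 by (cases "a = 0") auto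
    qed simp
    let ?SI = "shifted_sum I r s (\<lambda>b. C (Suc k) (h + b))"
    let ?SJ = "shifted_sum J r s (\<lambda>b. C 0 (h + b))"
    have "C k (Suc h) $ n = (?SI * ?G) $ n + F k * (?SJ * ?G) $ n + F k * (W * C 0 h) $ n"
      by (subst C_first_step) (simp add: shift)
    \<comment> \<open>At \<open>h = 0\<close> the descent from height 1 leaves
      \<open>W * C 0 0\<close>, which is \<open>?G\<close> itself; it matches the empty path in the
      recurrence for \<open>C k 0\<close>.\<close>
    also have "(W * C 0 h) $ n
        = (((if h = 0 then 1 else 0) + (if h = 0 then 0 else W * C 0 (h - 1))) * ?G) $ n"
      using down[of "h - 1"] by (cases h) (simp_all add: mult.assoc)
    also have "(?SI * ?G) $ n + F k * (?SJ * ?G) $ n + F k * \<dots>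
        = ((?SI + fps_const (F k) * ?SJ
            + fps_const (F k) * ((if h = 0 then 1 else 0) + (if h = 0 then 0 else W * C 0 (h - 1)))) * ?G) $ n"
      unfolding distrib_right mult.assoc[of "fps_const _"] by simp
    also have "?SI + fps_const (F k) * ?SJ
            + fps_const (F k) * ((if h = 0 then 1 else 0) + (if h = 0 then 0 else W * C 0 (h - 1)))
        = C k h"
      by (subst (2) C_first_step) simp
    finally show ?case .
  qed
qed

lemma C_height: "C k h = C k 0 * (W * P) ^ h"
  by (induction h) (simp_all add: C_Suc_height mult.assoc mult.commute[of "W * P"])

lemma C_unroll:
  "C k 0 = fps_const (F k) * (1 + P * fps_subst_y (family_gf2 J r s) (W * P))
     + fps_subst_y (family_gf2 I r s) (W * P) * C (Suc k) 0"
proof -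
  have "(W * P) $ 0 = 0" by (simp add: W_0)
  then have geo: "shifted_sum A r s (\<lambda>b. C k' 0 * (W * P) ^ b)
      = fps_subst_y (family_gf2 A r s) (W * P) * C k' 0" if "A = I \<or> A = J" for A k'
    using that shifted_sum_geometric fin_I fin_J by blast
  have "shifted_sum A r s (C k') = shifted_sum A r s (\<lambda>b. C k' 0 * (W * P) ^ b)" for A k'
    by (rule arg_cong[where f = "shifted_sum A r s"]) (rule ext, rule C_height)
  then show ?thesis
    using C_first_step[of k 0] geo[of I "Suc k"] geo[of J 0] by (simp add: distrib_left mult.commute)
qed

lemma subst_y_0: "fps_subst_y (family_gf2 I r s) G $ 0 = 0"
proof -
  have e: "{i \<in> I. r i = 0 \<and> s i = 0} = {}" using r_pos by force
  show ?thesis by (simp add: fps_subst_y_def family_gf2_def e)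
qed

text \<open>The shifted series satisfy \<open>F_k = F k + x F_(k+1)\<close>, so the right side obeys
  the recurrence of \<open>C_unroll\<close>. The difference \<open>D k\<close> is thus
  \<open>U(x, W P)\<close> times \<open>D (Suc k)\<close>; as that factor has constant term 0, all
  coefficients vanish by induction.\<close>

lemma C_functional_equation:
  "C k 0 = (Abs_fps (\<lambda>l. F (k + l)) oo fps_subst_y (family_gf2 I r s) (W * P))
     * (1 + P * fps_subst_y (family_gf2 J r s) (W * P))"
proof -
  let ?U = "fps_subst_y (family_gf2 I r s) (W * P)"
  let ?N = "1 + P * fps_subst_y (family_gf2 J r s) (W * P)"
  define D where "D k = C k 0 - (Abs_fps (\<lambda>l. F (k + l)) oo ?U) * ?N" for k
  have D: "D k = ?U * D (Suc k)" for k
  proof -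
    have "Abs_fps (\<lambda>l. F (k + l)) = fps_const (F k) + fps_X * Abs_fps (\<lambda>l. F (Suc k + l))"
      by (rule fps_ext) (auto simp: fps_X_mult_nth)
    then have "Abs_fps (\<lambda>l. F (k + l)) oo ?U
        = fps_const (F k) + ?U * (Abs_fps (\<lambda>l. F (Suc k + l)) oo ?U)"
      by (simp only: fps_compose_add_distrib fps_compose_mult_distrib[OF subst_y_0]
          fps_const_compose fps_X_fps_compose_startby0[OF subst_y_0])
    then show ?thesis
      unfolding D_def by (subst C_unroll) (simp add: algebra_simps)
  qed
  have "D k $ n = 0" for n
  proof (induction n arbitrary: k rule: less_induct)
    case (less n)
    have "?U $ a * D (Suc k) $ (n - a) = 0" if "a \<le> n" for a
      using less[of "n - a"] that subst_y_0 by (cases "a = 0") auto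
    then show ?case by (subst D) (auto simp: fps_mult_nth intro!: sum.neutral)
  qed
  then have "D k = 0" by (intro fps_ext) simp
  then show ?thesis by (simp add: D_def)
qed

end

section \<open>Indexed families and sets of steps\<close>

theorem theorem2p1:
  fixes I J K :: "'i set" and r s :: "'i \<Rightarrow> nat" and f :: "nat \<Rightarrow> complex"
  assumes "countable I" "countable J" "countable K"
    and "I \<inter> J = {}" "I \<inter> K = {}" "J \<inter> K = {}"
    and "\<And>i. i \<in> I \<union> J \<union> K \<Longrightarrow> r i > 0"
  defines "step \<equiv> (\<lambda>i. (int (r i), if i \<in> K then -1 else int (s i)))"
    and "UU \<equiv> {(int (r i), int (s i)) | i. i \<in> I}"
    and "VV \<equiv> {(int (r i), int (s i)) | i. i \<in> J}"
    and "WW \<equiv> {(int (r i), - 1 :: int) | i. i \<in> K}"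
    and "U \<equiv> family_gf2 I r s"
    and "V \<equiv> family_gf2 J r s"
    and "W \<equiv> family_gf K r"
    and "F \<equiv> Abs_fps (\<lambda>l. if l = 0 then 1 else f l)"
  shows
    \<comment> \<open>The index sets enumerate the steps without repetition: paths with steps in the sets.\<close>
    "(inj_on step (I \<union> J \<union> K) \<longrightarrow>
       (let P = path_gf f UU (UU \<union> VV \<union> WW) id
        in P = (F oo fps_subst_y U (W * P)) * (1 + P * fps_subst_y V (W * P))))
     \<and>
     \<comment> \<open>Repetitions allowed, steps distinguished by their index; finiteness says exactly that
        the formal series for U, V and W are well defined.\<close>
     ((\<forall>a b. finite {i \<in> I. r i = a \<and> s i = b}) \<and>
      (\<forall>a b. finite {i \<in> J. r i = a \<and> s i = b}) \<and>
      (\<forall>a. finite {i \<in> K. r i = a}) \<longrightarrow>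
       (let P = path_gf f I (I \<union> J \<union> K) step
        in P = (F oo fps_subst_y U (W * P)) * (1 + P * fps_subst_y V (W * P))))"
proof -
  have "step ` I = UU" "step ` J = VV" "step ` K = WW"
    unfolding UU_def VV_def WW_def Setcompr_eq_image
    using assms(5,6) by (auto simp: step_def intro!: image_cong)
  then have S: "step ` I = UU" "step ` (I \<union> J \<union> K) = UU \<union> VV \<union> WW"
    by (simp_all add: image_Un)
  have fin2: "let P = path_gf f I (I \<union> J \<union> K) step
        in P = (F oo fps_subst_y U (W * P)) * (1 + P * fps_subst_y V (W * P))"
    if "\<And>a b. finite {i \<in> I. r i = a \<and> s i = b}" "\<And>a b. finite {i \<in> J. r i = a \<and> s i = b}"
      "\<And>a. finite {i \<in> K. r i = a}"
  proof -
    \<comment> \<open>The value 1 at 0 prices the empty pending block, so that \<open>C 0 0\<close>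
      becomes the generating function of the weighted paths.\<close>
    let ?F = "\<lambda>l. if l = 0 then 1 else f l"
    interpret L: step_families I J K r s ?F
      using assms(4-7) that by unfold_locales
    have "step = L.step" by (auto simp: step_def L.step_def)
    then have "path_gf f I (I \<union> J \<union> K) step = L.C 0 0"
      by (simp add: path_gf_def L.C_def L.lattice_paths_eq open_weight_0[of ?F f])
    then show ?thesis
      using L.C_functional_equation[of 0] unfolding F_def U_def V_def W_def Let_def add_0 by simp
  qed
  have fin1: "let P = path_gf f UU (UU \<union> VV \<union> WW) id
        in P = (F oo fps_subst_y U (W * P)) * (1 + P * fps_subst_y V (W * P))"
    if inj: "inj_on step (I \<union> J \<union> K)"
  proof -
    \<comment> \<open>Indices counted by one coefficient of \<open>U\<close>, \<open>V\<close> or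
      \<open>W\<close> share a displacement, so injectivity leaves at most one of them and the
      indexed version applies.\<close>
    have fin: "finite X" if "X \<subseteq> I \<union> J \<union> K" "\<And>i. i \<in> X \<Longrightarrow> step i = c" for X c
    proof (rule inj_on_finite)
      show "inj_on step X" using inj that(1) by (rule inj_on_subset)
      show "step ` X \<subseteq> {c}" using that(2) by auto
    qed simp
    have "finite {i \<in> I. r i = a \<and> s i = b}" "finite {i \<in> J. r i = a \<and> s i = b}" for a b
      using assms(5,6) by (auto intro!: fin[where c = "(int a, int b)"] simp: step_def)
    moreover have "finite {i \<in> K. r i = a}" for a
      by (auto intro!: fin[where c = "(int a, -1)"] simp: step_def)
    moreover have "path_gf f UU (UU \<union> VV \<union> WW) id = path_gf f I (I \<union> J \<union> K) step"
      using path_gf_image[OF inj, of I f] S by auto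
    ultimately show ?thesis using fin2 by simp
  qed
  from fin1 fin2 show ?thesis by blast
qed

end
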